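(* Let $\mathcal S$ be a finite poset, $\theta=(\theta_0;\theta_s)_{s\in\mathcal S}$ an integral weight, and $V=(V_0;V_s)_{s\in\mathcal S}$ a $\mu_\theta$-semistable subspace representation of $\mathcal S$ over a field $\mathbb F$. Then there is a filtration by vector subspaces $$0=K^0\subset K^1\subset\dots\subset K^h=V_0,$$ inducing a filtration $0=V^0\subset V^1\subset\dots\subset V^h=V$ of $V$ with $V^i=V_{K^i}=(K^i;V_s\cap K^i)_{s\in\mathcal S}$, such that: (1) $V^i/V^{i-1}$ is $\mu_\theta$-stable for $i=1,\dots,h$, and (2) $\mu_\theta(V^i/V^{i-1})=\mu_\theta(V^{i+1}/V^i)$ for all $i=1,\dots,h-1$.
   Context: A subspace representation of $\mathcal S$ is a tuple $V=(V_0;V_s)_{s\in\mathcal S}$ with $V_0$ a finite dimensional $\mathbb F$-vector space and subspaces $V_s\subseteq V_0$ with $V_s\subseteq V_t$ if $s\prec t$. For a subspace $K\subseteq V_0$, $V_K=(K;V_s\cap K)_{s\in\mathcal S}$; for $K\subseteq K'$ the quotient $V_{K'}/V_K$ is the representation with ambient space $K'/K$ and subspaces $(V_s\cap K')/(V_s\cap K)$, viewed inside $K'/K$. A proper subrepresentation of $V$ is $V_K$ with $0\ne K\subsetneq V_0$. For a representation $V$ with $V_0\ne0$ the slope is $\mu_\theta(V)=\frac1{\dim V_0}\sum_{s\in\mathcal S}\theta_s\dim V_s$. $V$ (with $V_0\neq0$) is $\mu_\theta$-stable (resp. $\mu_\theta$-semistable) if $\mu_\theta(W)<\mu_\theta(V)$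 (resp. $\le$) for every proper subrepresentation $W$ of $V$. The inclusions $K^{i-1}\subset K^i$ are strict. *)

theory Defs
  imports Complex_Main "HOL-Algebra.AbelCoset" "Jordan_Normal_Form.Missing_VectorSpace"
begin

text \<open>
  Vector spaces are the \<open>vectorspace F M\<close> of the VectorSpace entry: \<open>F\<close> is a
  field and \<open>M\<close> a module over it in the sense of HOL-Algebra, both with explicit carriers, so
  that quotients can again be formed as spaces of cosets. A finite poset is a finite set \<open>S\<close>
  with a reflexive order relation \<open>r\<close> on it, so \<open>s \<prec> t\<close> is
  \<open>(s, t) \<in> r \<and> s \<noteq> t\<close>.
\<close>

text \<open>
  The additive structure of the quotient is the one of \<^const>\<open>A_FactGroup\<close>. The fields
  \<open>mult\<close> and \<open>one\<close> are present only because the record \<open>module\<close> extends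
  \<open>ring\<close>; no vector space notion refers to them.
\<close>

definition quotient_space :: "('a, 'v) module \<Rightarrow> 'v set \<Rightarrow> ('a, 'v set) module" where
  "quotient_space M K =
     \<lparr>carrier = a_rcosets\<^bsub>M\<^esub> K,
      mult = undefined,
      one = undefined,
      zero = K,
      add = (\<lambda>A B. A <+>\<^bsub>M\<^esub> B),
      smult = (\<lambda>a A. \<Union>x\<in>A. K +>\<^bsub>M\<^esub> (a \<odot>\<^bsub>M\<^esub> x))\<rparr>"

text \<open>
  The values of \<open>subsp\<close> outside the poset are irrelevant: nothing below looks at them.
\<close>

record ('a, 'v, 's) srep =
  ambient :: "('a, 'v) module"
  subsp :: "'s \<Rightarrow> 'v set"

definition subspace_rep ::
  "('a, 'b) ring_scheme \<Rightarrow> 's set \<Rightarrow> 's rel \<Rightarrow> ('a, 'v, 's) srep \<Rightarrow> bool" where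
  "subspace_rep F S r V \<longleftrightarrow>
     vectorspace F (ambient V) \<and> vectorspace.fin_dim F (ambient V) \<and>
     (\<forall>s\<in>S. VectorSpace.subspace F (subsp V s) (ambient V)) \<and>
     (\<forall>s\<in>S. \<forall>t\<in>S. (s, t) \<in> r \<and> s \<noteq> t \<longrightarrow> subsp V s \<subseteq> subsp V t)"

definition restrict_rep :: "('a, 'v, 's) srep \<Rightarrow> 'v set \<Rightarrow> ('a, 'v, 's) srep" where
  "restrict_rep V K =
     \<lparr>ambient = (ambient V)\<lparr>carrier := K\<rparr>, subsp = (\<lambda>s. subsp V s \<inter> K)\<rparr>"

text \<open>
  For \<open>W = restrict_rep V K'\<close> and \<open>U = restrict_rep V K\<close> with \<open>K \<subseteq> K'\<close>, the
  subspace \<open>(V s \<inter> K') / (V s \<inter> K)\<close>, viewed inside \<open>K' / K\<close>, is the set of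
  cosets \<open>K + x\<close> with \<open>x \<in> V s \<inter> K'\<close>.
\<close>

definition quotient_rep ::
  "('a, 'v, 's) srep \<Rightarrow> ('a, 'v, 's) srep \<Rightarrow> ('a, 'v set, 's) srep" where
  "quotient_rep W U =
     \<lparr>ambient = quotient_space (ambient W) (carrier (ambient U)),
      subsp = (\<lambda>s. (\<lambda>x. carrier (ambient U) +>\<^bsub>ambient W\<^esub> x) ` subsp W s)\<rparr>"

definition proper_subrep ::
  "('a, 'b) ring_scheme \<Rightarrow> ('a, 'v, 's) srep \<Rightarrow> ('a, 'v, 's) srep \<Rightarrow> bool" where
  "proper_subrep F V W \<longleftrightarrow>
     (\<exists>K. VectorSpace.subspace F K (ambient V) \<and> K \<noteq> {\<zero>\<^bsub>ambient V\<^esub>} \<and>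
          K \<noteq> carrier (ambient V) \<and> W = restrict_rep V K)"

text \<open>
  A weight is the pair of \<open>\<theta>\<^sub>0\<close> and the family of the \<open>\<theta> s\<close>; the slope does not
  involve \<open>\<theta>\<^sub>0\<close>.
\<close>

type_synonym 's weight = "int \<times> ('s \<Rightarrow> int)"

definition slope ::
  "('a, 'b) ring_scheme \<Rightarrow> 's set \<Rightarrow> 's weight \<Rightarrow> ('a, 'v, 's) srep \<Rightarrow> rat" where
  "slope F S \<theta> V =
     1 / of_nat (vectorspace.dim F (ambient V)) *
     (\<Sum>s\<in>S. of_int (snd \<theta> s) *
        of_nat (vectorspace.dim F ((ambient V)\<lparr>carrier := subsp V s\<rparr>)))"

definition slope_stable ::
  "('a, 'b) ring_scheme \<Rightarrow> 's set \<Rightarrow> 's rel \<Rightarrow> 's weight \<Rightarrow> ('a, 'v, 's) srep \<Rightarrow> bool" where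
  "slope_stable F S r \<theta> V \<longleftrightarrow>
     subspace_rep F S r V \<and> carrier (ambient V) \<noteq> {\<zero>\<^bsub>ambient V\<^esub>} \<and>
     (\<forall>W. proper_subrep F V W \<longrightarrow> slope F S \<theta> W < slope F S \<theta> V)"

definition slope_semistable ::
  "('a, 'b) ring_scheme \<Rightarrow> 's set \<Rightarrow> 's rel \<Rightarrow> 's weight \<Rightarrow> ('a, 'v, 's) srep \<Rightarrow> bool" where
  "slope_semistable F S r \<theta> V \<longleftrightarrow>
     subspace_rep F S r V \<and> carrier (ambient V) \<noteq> {\<zero>\<^bsub>ambient V\<^esub>} \<and>
     (\<forall>W. proper_subrep F V W \<longrightarrow> slope F S \<theta> W \<le> slope F S \<theta> V)"

end

theory Submission
  imports Defs
begin

text \<open>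
  For a subspace \<open>U\<close> of the ambient space write \<open>d U\<close> for its dimension and \<open>w U\<close> for the
  weighted sum of the dimensions of the \<open>V\<^sub>s \<inter> U\<close>, and let \<open>\<mu>\<close> be the slope of \<open>V\<close>.
  Semistability says that \<open>w U \<le> \<mu> * d U\<close> for every \<open>U\<close> (lemma \<open>weighted_dim_le\<close>). Call \<open>U\<close>
  critical if equality holds; \<open>0\<close> and \<open>V\<^sub>0\<close> are critical.

  Both \<open>d\<close> and \<open>w\<close> are additive on subquotients: by rank-nullity for the projection
  \<open>K' \<rightarrow> K' / K\<close> and its restrictions to the \<open>V\<^sub>s \<inter> L\<close>, a subspace \<open>K \<subset> L \<subseteq> K'\<close> induces a
  subrepresentation of \<open>V\<^bsub>K'\<^esub> / V\<^bsub>K\<^esub>\<close> of slope \<open>(w L - w K) / (d L - d K)\<close>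
  (lemma \<open>slope_restrict_quotient_rep\<close>), and every nonzero one arises in
  this way. If \<open>K\<close> and \<open>K'\<close> are critical, the quotient therefore has slope \<open>\<mu>\<close>; and the
  subrepresentation coming from \<open>K \<subset> L \<subset> K'\<close> has slope strictly below \<open>\<mu>\<close> exactly when
  \<open>L\<close> is not critical. So a chain of critical subspaces from \<open>0\<close> to \<open>V\<^sub>0\<close> that admits no
  critical refinement (lemma \<open>saturated_chain_exists\<close>) is a filtration of the required kind.
\<close>

section \<open>Saturated chains\<close>

definition saturated_chain ::
  "'v set set \<Rightarrow> 'v set \<Rightarrow> 'v set \<Rightarrow> nat \<Rightarrow> (nat \<Rightarrow> 'v set) \<Rightarrow> bool" where
  "saturated_chain C B T h K \<longleftrightarrow> K 0 = B \<and> K h = T \<and> (\<forall>i\<le>h. K i \<in> C) \<and>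
     (\<forall>i\<in>{1..h}. K (i - 1) \<subset> K i \<and> (\<forall>L\<in>C. \<not> (K (i - 1) \<subset> L \<and> L \<subset> K i)))"

lemma saturated_chain_Cons:
  assumes chain: "saturated_chain C A T h K" and B: "B \<in> C" "B \<subset> A"
    and gap: "\<And>L. L \<in> C \<Longrightarrow> \<not> (B \<subset> L \<and> L \<subset> A)"
  shows "saturated_chain C B T (Suc h) (case_nat B K)"
proof -
  have K: "K 0 = A" "K h = T" "\<And>i. i \<le> h \<Longrightarrow> K i \<in> C"
    and step: "\<And>i. i \<in> {1..h} \<Longrightarrow> K (i - 1) \<subset> K i"
    and no_gap: "\<And>i L. i \<in> {1..h} \<Longrightarrow> L \<in> C \<Longrightarrow> \<not> (K (i - 1) \<subset> L \<and> L \<subset> K i)"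
    using chain unfolding saturated_chain_def by blast+
  have "case_nat B K (i - 1) \<subset> case_nat B K i \<and>
      (\<forall>L\<in>C. \<not> (case_nat B K (i - 1) \<subset> L \<and> L \<subset> case_nat B K i))"
    if i: "i \<in> {1..Suc h}" for i
  proof (cases "i = 1")
    case True
    have "\<forall>L\<in>C. \<not> (B \<subset> L \<and> L \<subset> A)" using gap by blast
    with True show ?thesis using K(1) B(2) by (simp del: psubsetI)
  next
    case False
    then obtain j where j: "i = Suc (Suc j)" using i by (cases i; cases "i - 1") auto
    with i have "Suc j \<in> {1..h}" by simp
    then have "K j \<subset> K (Suc j)" "\<forall>L\<in>C. \<not> (K j \<subset> L \<and> L \<subset> K (Suc j))"
      using step[of "Suc j"] no_gap[of "Suc j"] by simp_all
    then show ?thesis unfolding j by simp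
  qed
  then show ?thesis
    using K B unfolding saturated_chain_def by (simp split: nat.split)
qed

text \<open>
  The strictly monotone rank \<open>d\<close> is bounded by \<open>d T\<close>, so repeatedly passing from \<open>B\<close> to a cover
  of \<open>B\<close> reaches \<open>T\<close> after finitely many steps.
\<close>

lemma saturated_chain_exists:
  fixes d :: "'v set \<Rightarrow> nat"
  assumes top: "T \<in> C" "\<And>X. X \<in> C \<Longrightarrow> X \<subseteq> T"
    and mono: "\<And>X Y. X \<in> C \<Longrightarrow> Y \<in> C \<Longrightarrow> X \<subset> Y \<Longrightarrow> d X < d Y"
    and "B \<in> C"
  shows "\<exists>h K. saturated_chain C B T h K"
  using \<open>B \<in> C\<close>
proof (induction "d T - d B" arbitrary: B rule: less_induct)
  case less
  show ?case
  proof (cases "B = T")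
    case True
    then have "saturated_chain C B T 0 (\<lambda>_. T)"
      using top by (simp add: saturated_chain_def)
    then show ?thesis by blast
  next
    case False
    then have "B \<subset> T" using top less.prems by blast
    \<comment> \<open>A member above \<open>B\<close> of least rank covers \<open>B\<close>, since anything in between has smaller rank.\<close>
    then obtain A where A: "A \<in> C" "B \<subset> A" and min: "\<And>L. L \<in> C \<Longrightarrow> B \<subset> L \<Longrightarrow> d A \<le> d L"
      using ex_has_least_nat[of "\<lambda>L. L \<in> C \<and> B \<subset> L" T d] top by blast
    have gap: "\<not> (B \<subset> L \<and> L \<subset> A)" if "L \<in> C" for L
      using min[OF that] mono[OF that A(1)] by (meson leD)
    have "d B < d A" by (rule mono[OF less.prems A])
    moreover have "d B < d T" by (rule mono[OF less.prems top(1) \<open>B \<subset> T\<close>])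
    ultimately have "d T - d A < d T - d B" by linarith
    from less.hyps[OF this A(1)] obtain h K where "saturated_chain C A T h K" by blast
    then show ?thesis using saturated_chain_Cons[OF _ less.prems A(2) gap] by blast
  qed
qed

section \<open>Subspaces of finite-dimensional spaces\<close>

lemma subspace_subset:
  assumes "VectorSpace.subspace F U M"
  shows "U \<subseteq> carrier M"
  using assms unfolding VectorSpace.subspace_def submodule_def by blast

lemma subspace_Int:
  assumes "VectorSpace.subspace F U M" "VectorSpace.subspace F L M"
  shows "VectorSpace.subspace F (U \<inter> L) M"
  using assms unfolding VectorSpace.subspace_def submodule_def by blast

lemma subspace_carrier:
  assumes "vectorspace F M"
  shows "VectorSpace.subspace F (carrier M) M"
proof -
  interpret vectorspace F M by fact
  show ?thesis by unfold_locales auto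
qed

lemma subspace_zero:
  assumes "vectorspace F M"
  shows "VectorSpace.subspace F {\<zero>\<^bsub>M\<^esub>} M"
proof -
  interpret vectorspace F M by fact
  show ?thesis by unfold_locales (auto simp: rmult_0)
qed

lemma subspace_in_restriction:
  assumes "VectorSpace.subspace F L M"
  shows "VectorSpace.subspace F U (M\<lparr>carrier := L\<rparr>) \<longleftrightarrow> VectorSpace.subspace F U M \<and> U \<subseteq> L"
proof -
  interpret vectorspace F M using assms unfolding VectorSpace.subspace_def by blast
  have "vectorspace F (vs L)" by (rule subspace_is_vs[OF assms])
  then show ?thesis
    using vectorspace_axioms subspace_subset[OF assms]
    by (auto simp: VectorSpace.subspace_def submodule_def vectorspace_def)
qed

text \<open>
  A maximal independent subset of \<open>U\<close> exists because independent sets of the whole space have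
  bounded size. It is a basis of \<open>U\<close>; if it had full size it would already be a basis of the
  whole space.
\<close>

lemma subspace_dim:
  assumes "vectorspace F M" and fd: "vectorspace.fin_dim F M" and U: "VectorSpace.subspace F U M"
  shows subspace_fin_dim: "vectorspace.fin_dim F (M\<lparr>carrier := U\<rparr>)"
    and subspace_dim_less: "U \<noteq> carrier M \<Longrightarrow>
      vectorspace.dim F (M\<lparr>carrier := U\<rparr>) < vectorspace.dim F M"
proof -
  interpret vectorspace F M by fact
  interpret U: vectorspace F "M\<lparr>carrier := U\<rparr>" by (rule subspace_is_vs[OF U])
  have sub: "submodule F U M" using U by simp
  have UM: "U \<subseteq> carrier M" by (rule subspace_subset[OF U])
  let ?P = "\<lambda>A. A \<subseteq> U \<and> lin_indpt A"
  have li: "U.lin_indpt A \<longleftrightarrow> lin_indpt A" if "A \<subseteq> U" for A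
    using span_li_not_depend(2)[OF that sub] by simp
  have "\<exists>A. finite A \<and> maximal A ?P"
  proof (rule maximal_exists[of ?P dim "{}"])
    show "?P {}" by (auto simp: lin_dep_def)
  qed (use li_le_dim[OF fd] UM in blast)
  then obtain A where A: "finite A" "maximal A ?P" by blast
  then have max: "maximal A (\<lambda>A. A \<subseteq> carrier (vs U) \<and> U.lin_indpt A)"
    unfolding maximal_def using li by auto
  have bas: "U.basis A" by (rule U.max_li_is_basis[OF max])
  then show "U.fin_dim" unfolding U.fin_dim_def U.basis_def using A by blast
  assume ne: "U \<noteq> carrier M"
  have AU: "A \<subseteq> U" and liA: "lin_indpt A" using A unfolding maximal_def by auto
  have "U.dim = card A" using U.dim_basis[OF A(1) bas] .
  moreover have "card A \<le> dim" using li_le_dim[OF fd] AU UM liA by blast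
  moreover have "card A \<noteq> dim"
  proof
    assume "card A = dim"
    then have "basis A" using dim_li_is_basis[OF fd A(1) _ liA] AU UM by auto
    then have "carrier M = span A" unfolding basis_def by simp
    also have "\<dots> = U" using bas span_li_not_depend(1)[OF AU sub] unfolding U.basis_def by simp
    finally show False using ne by simp
  qed
  ultimately show "U.dim < dim" by linarith
qed

lemma subspace_dim_strict_mono:
  assumes "vectorspace F M" "vectorspace.fin_dim F M"
    and "VectorSpace.subspace F U M" "VectorSpace.subspace F L M" "U \<subset> L"
  shows "vectorspace.dim F (M\<lparr>carrier := U\<rparr>) < vectorspace.dim F (M\<lparr>carrier := L\<rparr>)"
proof -
  have "vectorspace F (M\<lparr>carrier := L\<rparr>)"
    using assms vectorspace.subspace_is_vs by blast
  then show ?thesis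
    using subspace_dim_less[of F "M\<lparr>carrier := L\<rparr>" U] subspace_fin_dim[of F M L] assms
      subspace_in_restriction[of F L M U] by auto
qed

lemma dim_zero_subspace:
  assumes "vectorspace F M"
  shows "vectorspace.dim F (M\<lparr>carrier := {\<zero>\<^bsub>M\<^esub>}\<rparr>) = 0"
proof -
  interpret vectorspace F M by fact
  interpret Z: vectorspace F "vs {\<zero>\<^bsub>M\<^esub>}" 
    by (rule subspace_is_vs[OF subspace_zero[OF assms]])
  show ?thesis
    using Z.gen_ge_dim[of "{}"] Z.span_empty by simp
qed

section \<open>Quotient spaces\<close>

lemma abelian_subgroup_subspace:
  assumes "VectorSpace.subspace F K M"
  shows "abelian_subgroup K M"
proof -
  interpret vectorspace F M using assms unfolding VectorSpace.subspace_def by blast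
  interpret K: submodule F K M using assms unfolding VectorSpace.subspace_def by blast
  show ?thesis
  proof (rule abelian_subgroupI3)
    show "additive_subgroup K M"
    proof
      fix x assume "x \<in> K"
      then have "\<ominus>\<^bsub>M\<^esub> x \<in> K"
        using K.smult_closed[of "\<ominus>\<^bsub>F\<^esub> \<one>\<^bsub>F\<^esub>" x] K.subset smult_minus_1[of x]
        by (metis R.add.inv_closed R.one_closed subsetD)
      then show "inv\<^bsub>add_monoid M\<^esub> x \<in> K" by (simp add: a_inv_def)
    qed (use K.subset in auto)
  qed (rule M.abelian_group_axioms)
qed

text \<open>
  Cosets in a subspace and in the whole space agree, so the quotient of \<open>V\<^bsub>K'\<^esub>\<close> by \<open>V\<^bsub>K\<^esub>\<close> can
  be described with cosets taken in the ambient space of \<open>V\<close>.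
\<close>

lemma a_r_coset_restrict [simp]: "K +>\<^bsub>M\<lparr>carrier := L\<rparr>\<^esub> x = K +>\<^bsub>M\<^esub> x"
  by (simp add: a_r_coset_def')

context
  fixes F :: "('a, 'b) ring_scheme" and M :: "('a, 'v) module" and K :: "'v set"
  assumes K: "VectorSpace.subspace F K M"
begin

interpretation vectorspace F M
  using K unfolding VectorSpace.subspace_def by blast
interpretation K: submodule F K M
  using K unfolding VectorSpace.subspace_def by blast
interpretation S: abelian_subgroup K M
  by (rule abelian_subgroup_subspace[OF K])

lemma mem_own_coset: "x \<in> carrier M \<Longrightarrow> x \<in> K +>\<^bsub>M\<^esub> x"
  by (rule S.a_rcos_self)

lemma mem_coset_iff: "x \<in> K +>\<^bsub>M\<^esub> y \<longleftrightarrow> (\<exists>k\<in>K. x = k \<oplus>\<^bsub>M\<^esub> y)"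
  by (auto simp: a_r_coset_def')

lemma coset_eqI:
  assumes "x \<in> K +>\<^bsub>M\<^esub> y" "y \<in> carrier M"
  shows "K +>\<^bsub>M\<^esub> x = K +>\<^bsub>M\<^esub> y"
  using M.a_repr_independence[OF assms S.a_subgroup] by simp

lemma coset_eq_self_iff:
  assumes "x \<in> carrier M"
  shows "K +>\<^bsub>M\<^esub> x = K \<longleftrightarrow> x \<in> K"
  using M.a_coset_join1 M.a_coset_join2 S.a_subgroup assms by blast

lemma quotient_space_add:
  assumes "x \<in> carrier M" "y \<in> carrier M"
  shows "(K +>\<^bsub>M\<^esub> x) \<oplus>\<^bsub>quotient_space M K\<^esub> (K +>\<^bsub>M\<^esub> y) = K +>\<^bsub>M\<^esub> (x \<oplus>\<^bsub>M\<^esub> y)"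
  using S.a_rcos_sum[OF assms] by (simp add: quotient_space_def)

lemma quotient_space_smult:
  assumes a: "a \<in> carrier F" and y: "y \<in> carrier M"
  shows "a \<odot>\<^bsub>quotient_space M K\<^esub> (K +>\<^bsub>M\<^esub> y) = K +>\<^bsub>M\<^esub> (a \<odot>\<^bsub>M\<^esub> y)"
proof -
  have eq: "K +>\<^bsub>M\<^esub> (a \<odot>\<^bsub>M\<^esub> x) = K +>\<^bsub>M\<^esub> (a \<odot>\<^bsub>M\<^esub> y)" if x: "x \<in> K +>\<^bsub>M\<^esub> y" for x
  proof (rule coset_eqI)
    obtain k where k: "k \<in> K" "x = k \<oplus>\<^bsub>M\<^esub> y"
      using x unfolding mem_coset_iff by blast
    then have "a \<odot>\<^bsub>M\<^esub> x = a \<odot>\<^bsub>M\<^esub> k \<oplus>\<^bsub>M\<^esub> a \<odot>\<^bsub>M\<^esub> y"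
      using a y smult_r_distr subsetD[OF K.subset k(1)] by simp
    then show "a \<odot>\<^bsub>M\<^esub> x \<in> K +>\<^bsub>M\<^esub> (a \<odot>\<^bsub>M\<^esub> y)"
      unfolding mem_coset_iff using K.smult_closed[OF a k(1)] by blast
  qed (use a y in simp)
  have "(\<Union>x\<in>K +>\<^bsub>M\<^esub> y. K +>\<^bsub>M\<^esub> (a \<odot>\<^bsub>M\<^esub> x)) = K +>\<^bsub>M\<^esub> (a \<odot>\<^bsub>M\<^esub> y)"
  proof (rule SUP_eq_const)
    show "K +>\<^bsub>M\<^esub> y \<noteq> {}" using mem_own_coset[OF y] by blast
  qed (rule eq)
  then show ?thesis by (simp add: quotient_space_def)
qed

lemma carrier_quotient_space: "carrier (quotient_space M K) = (\<lambda>x. K +>\<^bsub>M\<^esub> x) ` carrier M"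
  by (auto simp: quotient_space_def A_RCOSETS_def')

lemma zero_quotient_space: "\<zero>\<^bsub>quotient_space M K\<^esub> = K +>\<^bsub>M\<^esub> \<zero>\<^bsub>M\<^esub>"
  using K.subset by (simp add: quotient_space_def)

lemma vectorspace_quotient_space: "vectorspace F (quotient_space M K)"
proof (rule vs_criteria)
  show "field F" by (rule field_axioms)
  show "\<forall>v\<in>carrier (quotient_space M K). \<exists>w\<in>carrier (quotient_space M K).
      v \<oplus>\<^bsub>quotient_space M K\<^esub> w = \<zero>\<^bsub>quotient_space M K\<^esub>"
  proof
    fix v assume "v \<in> carrier (quotient_space M K)"
    then obtain x where x: "x \<in> carrier M" "v = K +>\<^bsub>M\<^esub> x" by (auto simp: carrier_quotient_space)
    then have "v \<oplus>\<^bsub>quotient_space M K\<^esub> (K +>\<^bsub>M\<^esub> (\<ominus>\<^bsub>M\<^esub> x)) = \<zero>\<^bsub>quotient_space M K\<^esub>"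
      by (simp add: quotient_space_add zero_quotient_space M.r_neg)
    then show "\<exists>w\<in>carrier (quotient_space M K).
        v \<oplus>\<^bsub>quotient_space M K\<^esub> w = \<zero>\<^bsub>quotient_space M K\<^esub>"
      using x by (auto simp: carrier_quotient_space)
  qed
  show "\<forall>v w. v \<in> carrier (quotient_space M K) \<and> w \<in> carrier (quotient_space M K) \<longrightarrow>
      v \<oplus>\<^bsub>quotient_space M K\<^esub> w = w \<oplus>\<^bsub>quotient_space M K\<^esub> v"
    by (auto simp: carrier_quotient_space quotient_space_add M.a_comm)
qed (auto simp only: carrier_quotient_space zero_quotient_space quotient_space_add
    quotient_space_smult M.add.m_closed M.zero_closed smult_closed R.one_closed R.m_closed R.a_closed
    M.a_assoc M.r_zero smult_l_distr smult_r_distr smult_assoc1 smult_one ball_simps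
    intro!: imageI)

text \<open>
  If \<open>x\<close> and \<open>y \<in> L\<close> have the same coset, they differ by an element of \<open>K \<subseteq> L\<close>, so \<open>x \<in> L\<close>.
  This is what makes the subspaces of the quotient representation restrict compatibly with those
  of \<open>V\<close>.
\<close>

lemma coset_image_Int:
  assumes "VectorSpace.subspace F L M" "K \<subseteq> L" "U \<subseteq> carrier M"
  shows "(\<lambda>x. K +>\<^bsub>M\<^esub> x) ` U \<inter> (\<lambda>x. K +>\<^bsub>M\<^esub> x) ` L = (\<lambda>x. K +>\<^bsub>M\<^esub> x) ` (U \<inter> L)"
proof -
  interpret L: submodule F L M using assms unfolding VectorSpace.subspace_def by blast
  have "x \<in> L" if "x \<in> U" "y \<in> L" "K +>\<^bsub>M\<^esub> x = K +>\<^bsub>M\<^esub> y" for x y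
  proof -
    have "x \<in> K +>\<^bsub>M\<^esub> y" using mem_own_coset[of x] that assms by auto
    then show ?thesis using mem_coset_iff that(2) assms(2) by auto
  qed
  then show ?thesis by blast
qed

lemma linear_map_coset:
  assumes "VectorSpace.subspace F U M"
  shows "linear_map F (M\<lparr>carrier := U\<rparr>) (quotient_space M K) (\<lambda>x. K +>\<^bsub>M\<^esub> x)"
proof -
  interpret U: vectorspace F "M\<lparr>carrier := U\<rparr>" by (rule subspace_is_vs[OF assms])
  interpret Q: vectorspace F "quotient_space M K" by (rule vectorspace_quotient_space)
  have UM: "x \<in> carrier M" if "x \<in> U" for x using subspace_subset[OF assms] that by blast
  show ?thesis
    by unfold_locales
      (auto simp: module_hom_def carrier_quotient_space quotient_space_add quotient_space_smult UM)
qed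

text \<open>
  Rank-nullity for the projection restricted to \<open>U\<close>, whose kernel is \<open>U \<inter> K\<close>. The subspace
  \<open>U\<close> need not contain \<open>K\<close>; this generality is needed for the \<open>V\<^sub>s \<inter> L\<close>.
\<close>

lemma dim_coset_image:
  assumes fd: "fin_dim" and U: "VectorSpace.subspace F U M"
  shows "vectorspace.dim F ((quotient_space M K)\<lparr>carrier := (\<lambda>x. K +>\<^bsub>M\<^esub> x) ` U\<rparr>) +
    vectorspace.dim F (M\<lparr>carrier := U \<inter> K\<rparr>) = vectorspace.dim F (M\<lparr>carrier := U\<rparr>)"
proof -
  interpret T: linear_map F "M\<lparr>carrier := U\<rparr>" "quotient_space M K" "\<lambda>x. K +>\<^bsub>M\<^esub> x"
    by (rule linear_map_coset[OF U])
  have "T.V.fin_dim" using subspace_fin_dim[OF vectorspace_axioms fd U] .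
  moreover have "T.ker = {x \<in> U. K +>\<^bsub>M\<^esub> x = K}"
    unfolding T.ker_def by (simp add: quotient_space_def)
  then have "T.ker = U \<inter> K"
    using coset_eq_self_iff subspace_subset[OF U] by auto
  moreover have "T.im = (\<lambda>x. K +>\<^bsub>M\<^esub> x) ` U" by (simp add: T.im_def)
  ultimately show ?thesis using T.rank_nullity by simp
qed

lemma fin_dim_quotient_space:
  assumes "fin_dim"
  shows "vectorspace.fin_dim F (quotient_space M K)"
proof -
  interpret T: linear_map F "M\<lparr>carrier := carrier M\<rparr>" "quotient_space M K" "\<lambda>x. K +>\<^bsub>M\<^esub> x"
    by (rule linear_map_coset[OF subspace_carrier[OF vectorspace_axioms]])
  show ?thesis
    by (rule T.rank_nullity_main(2)) (use assms carrier_quotient_space in simp_all)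
qed

lemma subspace_coset_image:
  assumes "VectorSpace.subspace F U M"
  shows "VectorSpace.subspace F ((\<lambda>x. K +>\<^bsub>M\<^esub> x) ` U) (quotient_space M K)"
proof -
  interpret T: linear_map F "M\<lparr>carrier := U\<rparr>" "quotient_space M K" "\<lambda>x. K +>\<^bsub>M\<^esub> x"
    by (rule linear_map_coset[OF assms])
  show ?thesis using T.imT_is_subspace by (simp add: T.im_def)
qed

lemma subspace_of_quotient_spaceE:
  assumes L: "VectorSpace.subspace F L (quotient_space M K)"
  obtains U where "VectorSpace.subspace F U M" "K \<subseteq> U" "L = (\<lambda>x. K +>\<^bsub>M\<^esub> x) ` U"
proof
  interpret L: submodule F L "quotient_space M K"
    using L unfolding VectorSpace.subspace_def by blast
  let ?U = "{x \<in> carrier M. K +>\<^bsub>M\<^esub> x \<in> L}"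
  show "VectorSpace.subspace F ?U M"
  proof
    show "\<zero>\<^bsub>M\<^esub> \<in> ?U" using L.zero_closed by (simp add: zero_quotient_space)
  next
    fix x y assume "x \<in> ?U" "y \<in> ?U"
    then show "x \<oplus>\<^bsub>M\<^esub> y \<in> ?U"
      using L.m_closed[of "K +>\<^bsub>M\<^esub> x" "K +>\<^bsub>M\<^esub> y"] by (simp add: quotient_space_add)
  next
    fix a x assume "a \<in> carrier F" "x \<in> ?U"
    then show "a \<odot>\<^bsub>M\<^esub> x \<in> ?U"
      using L.smult_closed[of a "K +>\<^bsub>M\<^esub> x"] by (simp add: quotient_space_smult)
  qed auto
  show "K \<subseteq> ?U"
  proof
    fix x assume x: "x \<in> K"
    then have "K +>\<^bsub>M\<^esub> x = \<zero>\<^bsub>quotient_space M K\<^esub>"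
      using coset_eq_self_iff K.subset by (auto simp: quotient_space_def)
    then show "x \<in> ?U" using x K.subset L.zero_closed by auto
  qed
  show "L = (\<lambda>x. K +>\<^bsub>M\<^esub> x) ` ?U"
    using subspace_subset[OF L] by (auto simp: carrier_quotient_space)
qed

end

section \<open>Slopes of subquotients\<close>

definition weighted_dim ::
  "('a, 'b) ring_scheme \<Rightarrow> 's set \<Rightarrow> 's weight \<Rightarrow> ('a, 'v, 's) srep \<Rightarrow> 'v set \<Rightarrow> rat" where
  "weighted_dim F S \<theta> V U = (\<Sum>s\<in>S. of_int (snd \<theta> s) *
     of_nat (vectorspace.dim F ((ambient V)\<lparr>carrier := subsp V s \<inter> U\<rparr>)))"

abbreviation sub_dim :: "('a, 'b) ring_scheme \<Rightarrow> ('a, 'v, 's) srep \<Rightarrow> 'v set \<Rightarrow> nat" where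
  "sub_dim F V U \<equiv> vectorspace.dim F ((ambient V)\<lparr>carrier := U\<rparr>)"

lemma slope_restrict_rep:
  "slope F S \<theta> (restrict_rep V U) = weighted_dim F S \<theta> V U / of_nat (sub_dim F V U)"
  by (simp add: slope_def restrict_rep_def weighted_dim_def)

lemma slope_restrict_rep_carrier:
  assumes "subspace_rep F S r V"
  shows "slope F S \<theta> (restrict_rep V (carrier (ambient V))) = slope F S \<theta> V"
proof -
  have "subsp V s \<inter> carrier (ambient V) = subsp V s" if "s \<in> S" for s
    using assms that subspace_subset unfolding subspace_rep_def by blast
  then show ?thesis by (simp add: slope_def restrict_rep_def)
qed

context
  fixes F :: "('a, 'b) ring_scheme" and S :: "'s set" and r :: "'s rel"
    and V :: "('a, 'v, 's) srep" and K K' :: "'v set"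
  assumes V: "subspace_rep F S r V"
    and K: "VectorSpace.subspace F K (ambient V)"
    and K': "VectorSpace.subspace F K' (ambient V)"
    and KK': "K \<subseteq> K'"
begin

private abbreviation (input) "M \<equiv> ambient V"
private abbreviation (input) "M' \<equiv> (ambient V)\<lparr>carrier := K'\<rparr>"
private abbreviation (input) "\<pi> \<equiv> \<lambda>x. K +>\<^bsub>ambient V\<^esub> x"
private abbreviation (input) "Q \<equiv> quotient_rep (restrict_rep V K') (restrict_rep V K)"

private lemma quotient_setup:
  "vectorspace F M'" "vectorspace.fin_dim F M'" "VectorSpace.subspace F K M'"
  "s \<in> S \<Longrightarrow> VectorSpace.subspace F (subsp V s) M"
  using V K K' KK' subspace_in_restriction[OF K'] subspace_fin_dim[of F M]
    vectorspace.subspace_is_vs[of F M]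
  unfolding subspace_rep_def by auto

private lemma Q_simps: "ambient Q = quotient_space M' K" "subsp Q s = \<pi> ` (subsp V s \<inter> K')"
  by (simp_all add: quotient_rep_def restrict_rep_def)

lemma subspace_rep_quotient_rep: "subspace_rep F S r Q"
  unfolding subspace_rep_def Q_simps
proof (intro conjI ballI impI)
  show "vectorspace F (quotient_space M' K)" by (rule vectorspace_quotient_space[OF quotient_setup(3)])
  show "vectorspace.fin_dim F (quotient_space M' K)"
    by (rule fin_dim_quotient_space[OF quotient_setup(3,2)])
next
  fix s assume "s \<in> S"
  then have "VectorSpace.subspace F (subsp V s \<inter> K') M'"
    using subspace_Int[OF quotient_setup(4) K'] subspace_in_restriction[OF K'] by blast
  from subspace_coset_image[OF quotient_setup(3) this]
  show "VectorSpace.subspace F (\<pi> ` (subsp V s \<inter> K')) (quotient_space M' K)" by simp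
next
  fix s t assume "s \<in> S" "t \<in> S" "(s, t) \<in> r \<and> s \<noteq> t"
  then have "subsp V s \<subseteq> subsp V t" using V unfolding subspace_rep_def by simp
  then show "\<pi> ` (subsp V s \<inter> K') \<subseteq> \<pi> ` (subsp V t \<inter> K')"
    by (rule image_mono[OF Int_mono[OF _ subset_refl]])
qed

text \<open>
  The dimensions in the numerator and the denominator of the slope are each a difference of
  dimensions in \<open>V\<close>: the one for \<open>s\<close> comes from projecting \<open>V\<^sub>s \<inter> L\<close>, which meets \<open>K\<close> in
  \<open>V\<^sub>s \<inter> K\<close>.
\<close>

lemma slope_restrict_quotient_rep:
  assumes L: "VectorSpace.subspace F L M" "K \<subseteq> L" "L \<subseteq> K'"
  shows "slope F S \<theta> (restrict_rep Q (\<pi> ` L)) =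
    (weighted_dim F S \<theta> V L - weighted_dim F S \<theta> V K) /
    (of_nat (sub_dim F V L) - of_nat (sub_dim F V K))"
proof -
  have dim: "of_nat (vectorspace.dim F ((quotient_space M' K)\<lparr>carrier := \<pi> ` U\<rparr>)) =
      (of_nat (sub_dim F V U) - of_nat (sub_dim F V (U \<inter> K)) :: rat)"
    if "VectorSpace.subspace F U M" "U \<subseteq> K'" for U
  proof -
    have "VectorSpace.subspace F U M'" using that subspace_in_restriction[OF K'] by blast
    from arg_cong[OF dim_coset_image[OF quotient_setup(3,2) this], of "of_nat :: nat \<Rightarrow> rat"]
    show ?thesis by simp
  qed
  have "of_nat (vectorspace.dim F ((quotient_space M' K)\<lparr>carrier := \<pi> ` (subsp V s \<inter> K') \<inter> \<pi> ` L\<rparr>)) =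
      (of_nat (sub_dim F V (subsp V s \<inter> L)) - of_nat (sub_dim F V (subsp V s \<inter> K)) :: rat)"
    if "s \<in> S" for s
  proof -
    have "\<pi> ` (subsp V s \<inter> K') \<inter> \<pi> ` L = \<pi> ` (subsp V s \<inter> L)"
      using coset_image_Int[OF quotient_setup(3), of L "subsp V s \<inter> K'"] L subspace_in_restriction[OF K']
      by (simp add: Int_absorb1 Int_assoc)
    moreover have "subsp V s \<inter> L \<inter> K = subsp V s \<inter> K" using L by blast
    moreover have "subsp V s \<inter> L \<subseteq> K'" using L by blast
    ultimately show ?thesis
      using dim[OF subspace_Int[OF quotient_setup(4)[OF that] L(1)]] by simp
  qed
  moreover have "L \<inter> K = K" using L by blast
  ultimately show ?thesis
    unfolding slope_restrict_rep weighted_dim_def Q_simps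
    using dim[OF L(1,3)] by (simp add: right_diff_distrib sum_subtractf)
qed

lemma nonzero_quotient_rep:
  assumes "K \<noteq> K'"
  shows "carrier (ambient Q) \<noteq> {\<zero>\<^bsub>ambient Q\<^esub>}"
proof -
  obtain x where x: "x \<in> K'" "x \<notin> K" using assms KK' by blast
  then have "\<pi> x \<noteq> K" using coset_eq_self_iff[OF quotient_setup(3), of x] by auto
  moreover have "\<pi> x \<in> carrier (quotient_space M' K)"
    using x carrier_quotient_space[OF quotient_setup(3)] by auto
  ultimately show ?thesis by (auto simp: Q_simps quotient_space_def)
qed

text \<open>
  The correspondence between the subspaces of \<open>K' / K\<close> and those between \<open>K\<close> and \<open>K'\<close>;
  properness on both sides amounts to strictness of both inclusions.
\<close>

lemma proper_subrep_quotient_repE: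
  assumes "proper_subrep F Q W"
  obtains L where "VectorSpace.subspace F L M" "K \<subset> L" "L \<subset> K'"
    "W = restrict_rep Q (\<pi> ` L)"
proof -
  obtain X where X: "VectorSpace.subspace F X (quotient_space M' K)" "X \<noteq> {K}"
      "X \<noteq> carrier (quotient_space M' K)" and W: "W = restrict_rep Q X"
    using assms unfolding proper_subrep_def by (auto simp: Q_simps quotient_space_def)
  obtain L where L: "VectorSpace.subspace F L M'" "K \<subseteq> L" "X = \<pi> ` L"
    using subspace_of_quotient_spaceE[OF quotient_setup(3) X(1)] by auto
  then have L': "VectorSpace.subspace F L M" "L \<subseteq> K'"
    using subspace_in_restriction[OF K'] by auto
  have "\<pi> x = K" if "x \<in> K" for x
    using coset_eq_self_iff[OF quotient_setup(3), of x] that KK' by auto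
  moreover have "K \<noteq> {}" 
    using K unfolding VectorSpace.subspace_def submodule_def by blast
  ultimately have "\<pi> ` K = {K}" by auto
  then have "L \<noteq> K" using X L by auto
  moreover have "L \<noteq> K'" using X L carrier_quotient_space[OF quotient_setup(3)] by auto
  ultimately show ?thesis using that[OF L'(1)] L L' W by auto
qed

lemma slope_quotient_rep:
  "slope F S \<theta> Q = (weighted_dim F S \<theta> V K' - weighted_dim F S \<theta> V K) /
    (of_nat (sub_dim F V K') - of_nat (sub_dim F V K))"
proof -
  have "carrier (ambient Q) = \<pi> ` K'"
    using carrier_quotient_space[OF quotient_setup(3)] by (simp add: Q_simps)
  then show ?thesis
    using slope_restrict_rep_carrier[OF subspace_rep_quotient_rep, of \<theta>]
      slope_restrict_quotient_rep[OF K' KK', of \<theta>] by simp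
qed

end

lemma weighted_dim_zero:
  assumes "subspace_rep F S r V"
  shows "weighted_dim F S \<theta> V {\<zero>\<^bsub>ambient V\<^esub>} = 0"
proof -
  have vs: "vectorspace F (ambient V)" using assms unfolding subspace_rep_def by blast
  have "subsp V s \<inter> {\<zero>\<^bsub>ambient V\<^esub>} = {\<zero>\<^bsub>ambient V\<^esub>}" if "s \<in> S" for s
    using assms that unfolding subspace_rep_def VectorSpace.subspace_def submodule_def by blast
  then show ?thesis by (simp add: weighted_dim_def dim_zero_subspace[OF vs])
qed

lemma sub_dim_strict_mono:
  assumes "subspace_rep F S r V" "VectorSpace.subspace F U (ambient V)"
    "VectorSpace.subspace F L (ambient V)" "U \<subset> L"
  shows "sub_dim F V U < sub_dim F V L"
  using assms subspace_dim_strict_mono unfolding subspace_rep_def by blast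

lemma weighted_dim_carrier:
  assumes V: "subspace_rep F S r V" and ne: "carrier (ambient V) \<noteq> {\<zero>\<^bsub>ambient V\<^esub>}"
  shows "weighted_dim F S \<theta> V (carrier (ambient V)) =
    slope F S \<theta> V * of_nat (sub_dim F V (carrier (ambient V)))"
proof -
  have vs: "vectorspace F (ambient V)" using V unfolding subspace_rep_def by blast
  have "sub_dim F V {\<zero>\<^bsub>ambient V\<^esub>} < sub_dim F V (carrier (ambient V))"
    using sub_dim_strict_mono[OF V subspace_zero[OF vs] subspace_carrier[OF vs]]
      subspace_subset[OF subspace_zero[OF vs]] ne by blast
  then show ?thesis
    using slope_restrict_rep[of F S \<theta> V "carrier (ambient V)"]
    by (simp add: slope_restrict_rep_carrier[OF V])
qed

text \<open>
  Semistability with the denominators cleared. In this form it also covers the zero subspace,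
  which has no meaningful slope, and the whole space, neither of which is a proper
  subrepresentation.
\<close>

lemma weighted_dim_le:
  assumes ss: "slope_semistable F S r \<theta> V" and L: "VectorSpace.subspace F L (ambient V)"
  shows "weighted_dim F S \<theta> V L \<le> slope F S \<theta> V * of_nat (sub_dim F V L)"
proof -
  have V: "subspace_rep F S r V" and ne: "carrier (ambient V) \<noteq> {\<zero>\<^bsub>ambient V\<^esub>}"
    using ss unfolding slope_semistable_def by auto
  have vs: "vectorspace F (ambient V)" using V unfolding subspace_rep_def by blast
  consider "L = {\<zero>\<^bsub>ambient V\<^esub>}" | "L = carrier (ambient V)"
    | "L \<noteq> {\<zero>\<^bsub>ambient V\<^esub>}" "L \<noteq> carrier (ambient V)" by blast
  then show ?thesis
  proof cases
    case 1
    then show ?thesis using weighted_dim_zero[OF V, of \<theta>] dim_zero_subspace[OF vs] by simp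
  next
    case 2
    then show ?thesis using weighted_dim_carrier[OF V ne, of \<theta>] by simp
  next
    case 3
    have "\<zero>\<^bsub>ambient V\<^esub> \<in> L" using L unfolding VectorSpace.subspace_def submodule_def by blast
    then have "sub_dim F V {\<zero>\<^bsub>ambient V\<^esub>} < sub_dim F V L"
      using sub_dim_strict_mono[OF V subspace_zero[OF vs] L] 3(1) by blast
    moreover have "slope F S \<theta> (restrict_rep V L) \<le> slope F S \<theta> V"
      using ss L 3 unfolding slope_semistable_def proper_subrep_def by blast
    ultimately show ?thesis by (simp add: slope_restrict_rep divide_le_eq)
  qed
qed

section \<open>Critical subspaces\<close>

text \<open>
  The nonzero ones are the subspaces whose slope attains the bound of semistability.
\<close>

definition critical_subspaces ::
  "('a, 'b) ring_scheme \<Rightarrow> 's set \<Rightarrow> 's weight \<Rightarrow> ('a, 'v, 's) srep \<Rightarrow> 'v set set" where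
  "critical_subspaces F S \<theta> V = {U. VectorSpace.subspace F U (ambient V) \<and>
     weighted_dim F S \<theta> V U = slope F S \<theta> V * of_nat (sub_dim F V U)}"

text \<open>
  Two points of the line \<open>w = \<mu> * d\<close> span a segment of slope \<open>\<mu>\<close>.
\<close>

lemma slope_critical_quotient:
  assumes V: "subspace_rep F S r V"
    and K: "K \<in> critical_subspaces F S \<theta> V" and K': "K' \<in> critical_subspaces F S \<theta> V"
    and "K \<subset> K'"
  shows "slope F S \<theta> (quotient_rep (restrict_rep V K') (restrict_rep V K)) = slope F S \<theta> V"
proof -
  have sub: "VectorSpace.subspace F K (ambient V)" "VectorSpace.subspace F K' (ambient V)"
    using K K' unfolding critical_subspaces_def by auto
  have "sub_dim F V K < sub_dim F V K'"
    by (rule sub_dim_strict_mono[OF V sub \<open>K \<subset> K'\<close>])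
  then have nz: "of_nat (sub_dim F V K') - of_nat (sub_dim F V K) \<noteq> (0::rat)" by simp
  have "weighted_dim F S \<theta> V K' - weighted_dim F S \<theta> V K =
      slope F S \<theta> V * (of_nat (sub_dim F V K') - of_nat (sub_dim F V K))"
    using K K' by (simp add: critical_subspaces_def right_diff_distrib)
  moreover have "K \<subseteq> K'" using \<open>K \<subset> K'\<close> by blast
  ultimately show ?thesis
    using slope_quotient_rep[OF V sub, of \<theta>] nz by simp
qed

text \<open>
  A subspace \<open>L\<close> strictly between is not critical, so it lies strictly below the line
  \<open>w = \<mu> * d\<close> on which \<open>K\<close> lies; the segment from \<open>K\<close> to \<open>L\<close> has slope less than \<open>\<mu>\<close>.
\<close>

lemma stable_critical_quotient:
  assumes ss: "slope_semistable F S r \<theta> V"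
    and K: "K \<in> critical_subspaces F S \<theta> V" and K': "K' \<in> critical_subspaces F S \<theta> V"
    and "K \<subset> K'" and gap: "\<And>L. L \<in> critical_subspaces F S \<theta> V \<Longrightarrow> \<not> (K \<subset> L \<and> L \<subset> K')"
  shows "slope_stable F S r \<theta> (quotient_rep (restrict_rep V K') (restrict_rep V K))"
    (is "slope_stable F S r \<theta> ?Q")
proof -
  have V: "subspace_rep F S r V" using ss unfolding slope_semistable_def by blast
  have sub: "VectorSpace.subspace F K (ambient V)" "VectorSpace.subspace F K' (ambient V)"
    using K K' unfolding critical_subspaces_def by auto
  have KK': "K \<subseteq> K'" "K \<noteq> K'" using \<open>K \<subset> K'\<close> by auto
  have "slope F S \<theta> W < slope F S \<theta> ?Q" if W: "proper_subrep F ?Q W" for W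
  proof -
    obtain L where L: "VectorSpace.subspace F L (ambient V)" "K \<subset> L" "L \<subset> K'"
        "W = restrict_rep ?Q ((\<lambda>x. K +>\<^bsub>ambient V\<^esub> x) ` L)"
      using proper_subrep_quotient_repE[OF V sub KK'(1) W] by blast
    have "weighted_dim F S \<theta> V L \<le> slope F S \<theta> V * of_nat (sub_dim F V L)"
      by (rule weighted_dim_le[OF ss L(1)])
    moreover have "weighted_dim F S \<theta> V L \<noteq> slope F S \<theta> V * of_nat (sub_dim F V L)"
      using gap[of L] L unfolding critical_subspaces_def by blast
    moreover have "sub_dim F V K < sub_dim F V L"
      by (rule sub_dim_strict_mono[OF V sub(1) L(1,2)])
    ultimately have "(weighted_dim F S \<theta> V L - weighted_dim F S \<theta> V K) /
        (of_nat (sub_dim F V L) - of_nat (sub_dim F V K)) < slope F S \<theta> V"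
      using K by (simp add: critical_subspaces_def divide_less_eq right_diff_distrib)
    then show ?thesis
      using slope_restrict_quotient_rep[OF V sub KK'(1) L(1), of \<theta>] L
        slope_critical_quotient[OF V K K' \<open>K \<subset> K'\<close>] by simp
  qed
  then show ?thesis
    unfolding slope_stable_def
    using subspace_rep_quotient_rep[OF V sub KK'(1)] nonzero_quotient_rep[OF V sub KK']
    by blast
qed

theorem proposition2p4:
  fixes F :: "('a, 'b) ring_scheme"
    and S :: "'s set" and r :: "'s rel"
    and \<theta> :: "'s weight"
    and V :: "('a, 'v, 's) srep"
  assumes "field F"
    and "finite S" and "partial_order_on S r"
    and "subspace_rep F S r V"
    and "slope_semistable F S r \<theta> V"
  shows "\<exists>(h::nat) (K :: nat \<Rightarrow> 'v set).
    K 0 = {\<zero>\<^bsub>ambient V\<^esub>} \<and> K h = carrier (ambient V) \<and>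
    (\<forall>i\<le>h. VectorSpace.subspace F (K i) (ambient V)) \<and>
    (\<forall>i\<in>{1..h}. K (i - 1) \<subset> K i) \<and>
    (\<forall>i\<in>{1..h}. slope_stable F S r \<theta>
       (quotient_rep (restrict_rep V (K i)) (restrict_rep V (K (i - 1))))) \<and>
    (\<forall>i\<in>{1..h - 1}.
       slope F S \<theta> (quotient_rep (restrict_rep V (K i)) (restrict_rep V (K (i - 1)))) =
       slope F S \<theta> (quotient_rep (restrict_rep V (K (i + 1))) (restrict_rep V (K i))))"
proof -
  note V = \<open>subspace_rep F S r V\<close> and ss = \<open>slope_semistable F S r \<theta> V\<close>
  let ?C = "critical_subspaces F S \<theta> V"
  have vs: "vectorspace F (ambient V)" using V unfolding subspace_rep_def by blast
  have C: "VectorSpace.subspace F U (ambient V)" if "U \<in> ?C" for U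
    using that unfolding critical_subspaces_def by blast
  have zero: "{\<zero>\<^bsub>ambient V\<^esub>} \<in> ?C"
    using subspace_zero[OF vs] weighted_dim_zero[OF V, of \<theta>] dim_zero_subspace[OF vs]
    by (simp add: critical_subspaces_def)
  have top: "carrier (ambient V) \<in> ?C"
    using ss subspace_carrier[OF vs] weighted_dim_carrier[OF V, of \<theta>]
    unfolding slope_semistable_def critical_subspaces_def by blast
  obtain h K where "saturated_chain ?C {\<zero>\<^bsub>ambient V\<^esub>} (carrier (ambient V)) h K"
    using saturated_chain_exists[of _ ?C "sub_dim F V", OF top subspace_subset[OF C]
        sub_dim_strict_mono[OF V C C] zero] by blast
  then have K: "K 0 = {\<zero>\<^bsub>ambient V\<^esub>}" "K h = carrier (ambient V)"
    and KC: "\<And>i. i \<le> h \<Longrightarrow> K i \<in> ?C"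
    and step: "\<And>i. i \<in> {1..h} \<Longrightarrow> K (i - 1) \<subset> K i"
    and gap: "\<And>i L. i \<in> {1..h} \<Longrightarrow> L \<in> ?C \<Longrightarrow> \<not> (K (i - 1) \<subset> L \<and> L \<subset> K i)"
    unfolding saturated_chain_def by blast+
  have mem: "K i \<in> ?C" "K (i - 1) \<in> ?C" if "i \<in> {1..h}" for i
    using KC that by auto
  have stable: "slope_stable F S r \<theta>
      (quotient_rep (restrict_rep V (K i)) (restrict_rep V (K (i - 1))))" if "i \<in> {1..h}" for i
    using stable_critical_quotient[OF ss mem(2,1)[OF that] step[OF that] gap[OF that]] .
  have slope: "slope F S \<theta> (quotient_rep (restrict_rep V (K i)) (restrict_rep V (K (i - 1)))) =
      slope F S \<theta> V" if "i \<in> {1..h}" for i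
    using slope_critical_quotient[OF V mem(2,1)[OF that] step[OF that]] .
  have "slope F S \<theta> (quotient_rep (restrict_rep V (K i)) (restrict_rep V (K (i - 1)))) =
      slope F S \<theta> (quotient_rep (restrict_rep V (K (i + 1))) (restrict_rep V (K i)))"
    if "i \<in> {1..h - 1}" for i
    using slope[of i] slope[of "i + 1"] that by auto
  then show ?thesis
    using K KC[THEN C] step stable by (intro exI[of _ h] exI[of _ K] conjI ballI allI impI)
qed

end
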